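(* Let $\mathbb{F}\in\{\mathbb{R},\mathbb{C},\mathbb{H}\}$. Let $A=\operatorname{Arrow}(D,u,v,\alpha)\in\mathbb{F}^{n\times n}$ be a non-singular arrowhead matrix with the tip at position $A_{ii}=\alpha$, and let $P$ be the permutation matrix of the permutation $p=(1,2,\dots,i-1,n,i,i+1,\dots,n-1)$. (1) If all $d_j\neq0$, $j=1,\dots,n-1$, then the inverse of $A$ is the diagonal-plus-rank-one matrix $$ A^{-1}=\Delta+x\rho y^\star, $$ where $$ \Delta=P\begin{bmatrix} D^{-1} & 0 \\ 0 & 0 \end{bmatrix}P^T,\quad x=P\begin{bmatrix} D^{-1}u \\ -1 \end{bmatrix},\quad y=P\begin{bmatrix} D^{-\star}v \\ -1 \end{bmatrix},\quad \rho=(\alpha-v^\star D^{-1}u)^{-1}. $$ (2) If $d_j=0$ for some $j\in\{1,\dots,n-1\}$, then the inverse of $A$ is an arrowhead matrix in which the tip of the arrow is at the diagonal position at which the zero $d_j$ stands in $A$, and the $(i,i)$ entry is zero (the tip and the zero on the shaft change places). In particular, let $\hat P$ be the permutation matrix of the permutation $\hat p=(1,2,\dots,j-1,n,j,j+1,\dots,n-1)$, and partition $$ D=\begin{bmatrix} D_1 & 0 & 0 \\ 0 & 0 & 0 \\ 0 & 0 & D_2 \end{bmatrix},\quad u=\begin{bmatrix} u_1 \\ u_j \\ u_2 \end{bmatrix},\quad v=\begin{bmatrix} v_1 \\ v_j \\ v_2 \end{bmatrix}, $$ where the middle row and column correspond to index $j$ (so $u_j,v_j\in\mathbb{F}$,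 while $u_1,u_2,v_1,v_2$ are subvectors). Then $$ A^{-1}=P\hat P\begin{bmatrix} \hat D & \hat u \\ \hat v^\star & \hat\alpha \end{bmatrix}\hat P^TP^T, $$ where $$ \hat D=\begin{bmatrix} D_1^{-1} & 0 & 0 \\ 0 & D_2^{-1} & 0 \\ 0 & 0 & 0 \end{bmatrix},\quad \hat u=\begin{bmatrix} -D_1^{-1}u_1 \\ -D_2^{-1}u_2 \\ 1 \end{bmatrix}u_j^{-1},\quad \hat v=\begin{bmatrix} -D_1^{-\star}v_1 \\ -D_2^{-\star}v_2 \\ 1 \end{bmatrix}v_j^{-1}, $$ $$ \hat\alpha=v_j^{-\star}\left(-\alpha+v_1^\star D_1^{-1}u_1+v_2^\star D_2^{-1}u_2\right)u_j^{-1}. $$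
   Context: $\mathbb{H}$ is the (non-commutative) skew field of real quaternions; products are taken in the order written. $\star$ denotes the transpose of a real matrix, the conjugate transpose of a complex or quaternionic matrix or vector, and the conjugate of a scalar; $X^{-\star}=(X^{-1})^\star$. Permutation matrices: the permutation matrix $P$ of $p=(p_1,\dots,p_n)$ is the one with $(Pa)_k=a_{p_k}$ for every vector $a$, i.e. $P_{k,p_k}=1$ and all other entries $0$. Thus $P$ above moves the last entry of a vector to position $i$ and keeps the order of the others (and likewise $\hat P$ with position $j$). Arrowhead matrix: given a diagonal matrix $D$ of order $n-1$ with diagonal elements $d_1,\dots,d_{n-1}\in\mathbb{F}$, vectors $u,v\in\mathbb{F}^{n-1}$ and $\alpha\in\mathbb{F}$, $\operatorname{Arrow}(D,u,v,\alpha)$ is the matrix $\begin{bmatrix} D & u \\ v^\star & \alpha \end{bmatrix}\in\mathbb{F}^{n\times n}$ or any symmetric permutation of it. The arrowhead matrix with the tip at position $(i,i)$ is $A=P\begin{bmatrix} D & u \\ v^\star & \alpha \end{bmatrix}P^T$ with $P$ the permutation matrix of $p=(1,\dots,i-1,n,i,\dots,n-1)$. The element $d_j$ then stands at diagonal position $j$ of $A$ if $j<i$ and at diagonal position $j+1$ if $j\ge i$. The tip of an arrowhead matrix is the diagonal position of $\alpha$; the shaft consists of the diagonal elements $d_j$. Diagonal-plus-rank-one matrix: a matrix of the form $\Delta+x\rho y^\star$ with $\Delta\in\mathbb{F}^{n\times n}$ diagonal, $x,y\in\mathbb{F}^n$, $\rho\in\mathbb{F}$. In the partition above, the blocks with subscript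 $1$ or $2$ may be empty. *)

theory Defs
  imports Complex_Main "Jordan_Normal_Form.Matrix"
begin

section \<open>Quaternions\<close>

datatype quat = Quat (qre: real) (qi: real) (qj: real) (qk: real)

lemma quat_eq_iff: "p = q \<longleftrightarrow> qre p = qre q \<and> qi p = qi q \<and> qj p = qj q \<and> qk p = qk q"
  by (cases p; cases q) auto

definition qnorm2 :: "quat \<Rightarrow> real" where
  "qnorm2 q = (qre q)\<^sup>2 + (qi q)\<^sup>2 + (qj q)\<^sup>2 + (qk q)\<^sup>2"

lemma qnorm2_eq_0_iff: "qnorm2 q = 0 \<longleftrightarrow> qre q = 0 \<and> qi q = 0 \<and> qj q = 0 \<and> qk q = 0"
  unfolding qnorm2_def by (simp add: add_nonneg_eq_0_iff)

instantiation quat :: division_ring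
begin

definition zero_quat :: quat where "0 = Quat 0 0 0 0"
definition one_quat :: quat where "1 = Quat 1 0 0 0"
definition plus_quat :: "quat \<Rightarrow> quat \<Rightarrow> quat" where
  "p + q = Quat (qre p + qre q) (qi p + qi q) (qj p + qj q) (qk p + qk q)"
definition uminus_quat :: "quat \<Rightarrow> quat" where
  "- p = Quat (- qre p) (- qi p) (- qj p) (- qk p)"
definition minus_quat :: "quat \<Rightarrow> quat \<Rightarrow> quat" where
  "p - q = Quat (qre p - qre q) (qi p - qi q) (qj p - qj q) (qk p - qk q)"
definition times_quat :: "quat \<Rightarrow> quat \<Rightarrow> quat" where
  "p * q = Quat
     (qre p * qre q - qi p * qi q - qj p * qj q - qk p * qk q)
     (qre p * qi q + qi p * qre q + qj p * qk q - qk p * qj q)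
     (qre p * qj q - qi p * qk q + qj p * qre q + qk p * qi q)
     (qre p * qk q + qi p * qj q - qj p * qi q + qk p * qre q)"
definition inverse_quat :: "quat \<Rightarrow> quat" where
  "inverse p = Quat (qre p / qnorm2 p) (- qi p / qnorm2 p) (- qj p / qnorm2 p) (- qk p / qnorm2 p)"
definition divide_quat :: "quat \<Rightarrow> quat \<Rightarrow> quat" where
  "divide_quat p q = p * inverse q"

lemmas quat_arith_defs = zero_quat_def one_quat_def plus_quat_def uminus_quat_def
  minus_quat_def times_quat_def

instance
proof
  fix p :: quat
  assume "p \<noteq> 0"
  then have nz: "qnorm2 p \<noteq> 0"
    by (auto simp: qnorm2_eq_0_iff quat_eq_iff zero_quat_def)
  show "inverse p * p = 1" "p * inverse p = 1"
    using nz
    by (auto simp: quat_eq_iff quat_arith_defs inverse_quat_def add_divide_distrib[symmetric]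
        diff_divide_distrib[symmetric] qnorm2_def power2_eq_square divide_simps)
next
  show "inverse (0 :: quat) = 0"
    by (simp add: quat_eq_iff zero_quat_def inverse_quat_def)
qed (auto simp: quat_eq_iff quat_arith_defs divide_quat_def algebra_simps)

end

instantiation quat :: conjugate
begin

definition conjugate_quat :: "quat \<Rightarrow> quat" where
  "conjugate q = Quat (qre q) (- qi q) (- qj q) (- qk q)"

instance by standard (auto simp: conjugate_quat_def quat_eq_iff)

end

section \<open>The scalar domain: the reals, the complex numbers or the quaternions\<close>

text \<open>
  The map \<open>to_quat\<close> is automatically injective, so the types of this class are, up to
  isomorphism of skew fields with conjugation, exactly the real numbers, the complex numbers and
  the quaternions. Conjugation reverses products, hence the library class
  \<open>conjugatable_ring\<close> does not apply to the quaternions.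
\<close>

class real_complex_quat = division_ring + conjugate +
  fixes to_quat :: "'a \<Rightarrow> quat"
  assumes to_quat_add: "to_quat (x + y) = to_quat x + to_quat y"
    and to_quat_mult: "to_quat (x * y) = to_quat x * to_quat y"
    and to_quat_one: "to_quat 1 = 1"
    and to_quat_conjugate: "to_quat (conjugate x) = conjugate (to_quat x)"
    and range_to_quat:
      "range to_quat = {q. qi q = 0 \<and> qj q = 0 \<and> qk q = 0} \<or>
       range to_quat = {q. qj q = 0 \<and> qk q = 0} \<or>
       range to_quat = UNIV"

instantiation real :: real_complex_quat
begin

definition to_quat_real :: "real \<Rightarrow> quat" where "to_quat x = Quat x 0 0 0"

instance
proof
  have "range (to_quat :: real \<Rightarrow> quat) = {q. qi q = 0 \<and> qj q = 0 \<and> qk q = 0}"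
    by (auto simp: to_quat_real_def image_iff quat_eq_iff)
  then show "range (to_quat :: real \<Rightarrow> quat) = {q. qi q = 0 \<and> qj q = 0 \<and> qk q = 0} \<or>
       range (to_quat :: real \<Rightarrow> quat) = {q. qj q = 0 \<and> qk q = 0} \<or>
       range (to_quat :: real \<Rightarrow> quat) = UNIV" by blast
qed (auto simp: to_quat_real_def quat_eq_iff quat_arith_defs conjugate_quat_def)

end

instantiation complex :: real_complex_quat
begin

definition to_quat_complex :: "complex \<Rightarrow> quat" where "to_quat z = Quat (Re z) (Im z) 0 0"

instance
proof
  have "q \<in> range (to_quat :: complex \<Rightarrow> quat)" if "qj q = 0" "qk q = 0" for q
    using that by (intro image_eqI[of _ _ "Complex (qre q) (qi q)"])
      (auto simp: to_quat_complex_def quat_eq_iff)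
  then have "range (to_quat :: complex \<Rightarrow> quat) = {q. qj q = 0 \<and> qk q = 0}"
    by (auto simp: to_quat_complex_def)
  then show "range (to_quat :: complex \<Rightarrow> quat) = {q. qi q = 0 \<and> qj q = 0 \<and> qk q = 0} \<or>
       range (to_quat :: complex \<Rightarrow> quat) = {q. qj q = 0 \<and> qk q = 0} \<or>
       range (to_quat :: complex \<Rightarrow> quat) = UNIV" by blast
qed (auto simp: to_quat_complex_def quat_eq_iff quat_arith_defs conjugate_quat_def)

end

instantiation quat :: real_complex_quat
begin

definition to_quat_quat :: "quat \<Rightarrow> quat" where "to_quat q = q"

instance by standard (auto simp: to_quat_quat_def)

end

section \<open>Matrices over a skew field\<close>

text \<open>
  The two-sided inverse of a matrix, written with the library's \<open>inverts_mat\<close>; it is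
  unique if it exists, and meaningful only then.
\<close>

definition mat_inv :: "'a :: semiring_1 mat \<Rightarrow> 'a mat" where
  "mat_inv A = (THE B. inverts_mat A B \<and> inverts_mat B A)"

definition mat_star :: "'a :: conjugate mat \<Rightarrow> 'a mat" where
  "mat_star A = map_mat conjugate (transpose_mat A)"

definition mat_of_col :: "'a vec \<Rightarrow> 'a mat" where
  "mat_of_col u = mat_of_cols (dim_vec u) [u]"

definition mat_of_scalar :: "'a \<Rightarrow> 'a mat" where
  "mat_of_scalar c = mat 1 1 (\<lambda>_. c)"

text \<open>Multiplication of a vector by a scalar from the right.\<close>

definition vec_mult_right :: "'a :: times vec \<Rightarrow> 'a \<Rightarrow> 'a vec" where
  "vec_mult_right u c = map_vec (\<lambda>a. a * c) u"

section \<open>Arrowhead matrices\<close>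

text \<open>
  Indices start at 0. A permutation of \<open>{0..<n}\<close> is given as the function
  \<open>k \<mapsto> p\<^sub>k\<close>, and its matrix maps \<open>a\<close> to the vector with entries
  \<open>a (p k)\<close>. The permutation \<open>tip_perm n i\<close> is
  \<open>(0, \<dots>, i - 1, n - 1, i, \<dots>, n - 2)\<close>.
\<close>

definition perm_mat :: "nat \<Rightarrow> (nat \<Rightarrow> nat) \<Rightarrow> 'a :: zero_neq_one mat" where
  "perm_mat n p = mat n n (\<lambda>(k, l). if l = p k then 1 else 0)"

definition tip_perm :: "nat \<Rightarrow> nat \<Rightarrow> nat \<Rightarrow> nat" where
  "tip_perm n i k = (if k < i then k else if k = i then n - 1 else k - 1)"

text \<open>The block matrix with rows \<open>(D, u)\<close> and \<open>(v\<^sup>\<star>, \<alpha>)\<close>.\<close>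

definition arrow_block :: "'a :: {zero, conjugate} mat \<Rightarrow> 'a vec \<Rightarrow> 'a vec \<Rightarrow> 'a \<Rightarrow> 'a mat" where
  "arrow_block D u v \<alpha> =
     four_block_mat D (mat_of_col u) (mat_of_row (conjugate v)) (mat_of_scalar \<alpha>)"

definition arrow_mat ::
    "nat \<Rightarrow> nat \<Rightarrow> 'a :: {semiring_1, conjugate} mat \<Rightarrow> 'a vec \<Rightarrow> 'a vec \<Rightarrow> 'a \<Rightarrow> 'a mat" where
  "arrow_mat n i D u v \<alpha> =
     perm_mat n (tip_perm n i) * arrow_block D u v \<alpha> * transpose_mat (perm_mat n (tip_perm n i))"

text \<open>\<open>X\<close> is an arrowhead matrix of order \<open>n\<close> with the tip at position \<open>(i, i)\<close>.\<close>

definition arrowhead_with_tip :: "nat \<Rightarrow> nat \<Rightarrow> 'a :: {semiring_1, conjugate} mat \<Rightarrow> bool" where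
  "arrowhead_with_tip n i X \<longleftrightarrow> i < n \<and>
     (\<exists>D u v \<alpha>. D \<in> carrier_mat (n - 1) (n - 1) \<and> diagonal_mat D \<and>
        u \<in> carrier_vec (n - 1) \<and> v \<in> carrier_vec (n - 1) \<and> X = arrow_mat n i D u v \<alpha>)"

text \<open>The diagonal position in \<open>arrow_mat n i D u v \<alpha>\<close> at which the \<open>j\<close>-th diagonal element of \<open>D\<close> stands.\<close>

definition shaft_pos :: "nat \<Rightarrow> nat \<Rightarrow> nat" where
  "shaft_pos i j = (if j < i then j else j + 1)"

end

theory Submission
  imports Defs
begin

text \<open>
  Conjugation with a permutation matrix is a simultaneous renumbering of rows and columns, which
  commutes with products and inverses, so everything reduces to the tip at the last position.
  There the claimed inverse is multiplied with the block matrix from the right, which suffices as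
  the block matrix is known to be invertible. The non-vanishing of the scalars that are inverted
  follows from the triviality of the kernel, respectively from the absence of a zero row.
\<close>

section \<open>Conjugation\<close>

text \<open>There is no commutative determinant to work with, and conjugation reverses products, so
  each formula comes from solving M X = I for the block matrix M by elimination, with all factors
  kept in order. If no shaft element is zero, the shaft rows express every coordinate through the
  tip coordinate, and the tip row has the Schur complement of D as its pivot. If d_j = 0, shaft row
  j contains only the tip coordinate and has the pivot u_j; the other shaft rows give their own
  coordinates, and the tip row remains for coordinate j, with the conjugate of v_j as pivot. This
  exchange between row j and the tip row is what moves the tip. The partitioned formula skips the
  index j, which is awkward to multiply out; it is therefore derived from an entry formula in the
  original numbering.\<close>

lemma conjugate_quat_hom:
  fixes x y :: quat
  shows "conjugate (x + y) = conjugate x + conjugate y"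
    and "conjugate (x * y) = conjugate y * conjugate x"
    and "conjugate (1 :: quat) = 1"
  by (auto simp: conjugate_quat_def quat_arith_defs quat_eq_iff algebra_simps)

context real_complex_quat
begin

text \<open>For nonzero \<open>x\<close> the product \<open>to_quat x * to_quat (inverse x)\<close>
  is 1. The resulting injectivity lets the laws of conjugation be pulled back from the
  quaternions.\<close>

lemma to_quat_eq_0: "to_quat x = 0 \<Longrightarrow> x = 0"
  using to_quat_mult[of x "inverse x"] to_quat_one by (cases "x = 0") auto

lemma to_quat_inj: "to_quat x = to_quat y \<Longrightarrow> x = y"
  using to_quat_add[of "x - y" y] to_quat_eq_0[of "x - y"] by simp

lemma conjugate_add: "conjugate (x + y) = conjugate x + conjugate y"
  by (rule to_quat_inj) (simp add: to_quat_add to_quat_conjugate conjugate_quat_hom)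

lemma conjugate_mult: "conjugate (x * y) = conjugate y * conjugate x"
  by (rule to_quat_inj) (simp add: to_quat_mult to_quat_conjugate conjugate_quat_hom)

lemma conjugate_1: "conjugate 1 = 1"
  by (rule to_quat_inj) (simp add: to_quat_one to_quat_conjugate conjugate_quat_hom)

lemma conjugate_0: "conjugate 0 = 0"
  using conjugate_add[of 0 0] by simp

lemma conjugate_uminus: "conjugate (- x) = - conjugate x"
  using conjugate_add[of "- x" x] by (simp add: conjugate_0 eq_neg_iff_add_eq_0)

lemma conjugate_eq_0: "conjugate x = 0 \<longleftrightarrow> x = 0"
  using conjugate_cancel_iff[of x 0] by (simp add: conjugate_0)

lemma conjugate_inverse: "conjugate (inverse x) = inverse (conjugate x)"
proof (cases "x = 0")
  case False
  then have "conjugate x * conjugate (inverse x) = 1"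
    by (simp add: conjugate_mult[symmetric] conjugate_1)
  then show ?thesis
    by (simp add: inverse_unique)
qed (simp add: conjugate_0)

end

lemmas conjugate_simps =
  conjugate_mult conjugate_1 conjugate_0 conjugate_uminus conjugate_inverse

section \<open>Inverses of matrices over a ring\<close>

lemma index_mult_mat_sum:
  assumes "A \<in> carrier_mat a n" "B \<in> carrier_mat n b" "k < a" "l < b"
  shows "(A * B) $$ (k, l) = (\<Sum>r<n. A $$ (k, r) * B $$ (r, l))"
  using assms by (auto simp: scalar_prod_def lessThan_atLeast0 intro!: sum.cong)

text \<open>\<open>inverts_mat\<close> takes the size of the identity from its left factor;
  comparing the columns of both products with those of the identities fixes the size of
  \<open>B\<close>.\<close>

lemma inverts_mat_carrier:
  assumes "A \<in> carrier_mat n n" "inverts_mat A B" "inverts_mat B A"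
  shows "B \<in> carrier_mat n n" "A * B = 1\<^sub>m n" "B * A = 1\<^sub>m n"
proof -
  have "dim_col B = n" "dim_row B = n"
    using assms unfolding inverts_mat_def
    by (metis carrier_matD index_mult_mat(2,3) index_one_mat(2,3))+
  then show "B \<in> carrier_mat n n" "A * B = 1\<^sub>m n" "B * A = 1\<^sub>m n"
    using assms by (auto simp: inverts_mat_def)
qed

lemma invertible_mat_iff:
  assumes "A \<in> carrier_mat n n"
  shows "invertible_mat A \<longleftrightarrow> (\<exists>B \<in> carrier_mat n n. A * B = 1\<^sub>m n \<and> B * A = 1\<^sub>m n)"
proof
  assume "invertible_mat A"
  then obtain B where "inverts_mat A B" "inverts_mat B A"
    unfolding invertible_mat_def by blast
  from inverts_mat_carrier[OF assms this]
  show "\<exists>B \<in> carrier_mat n n. A * B = 1\<^sub>m n \<and> B * A = 1\<^sub>m n"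
    by blast
next
  assume "\<exists>B \<in> carrier_mat n n. A * B = 1\<^sub>m n \<and> B * A = 1\<^sub>m n"
  then obtain B where "B \<in> carrier_mat n n" "A * B = 1\<^sub>m n" "B * A = 1\<^sub>m n"
    by blast
  with assms show "invertible_mat A"
    unfolding invertible_mat_def inverts_mat_def by (intro conjI exI[of _ B]) simp_all
qed

text \<open>Any two-sided inverse \<open>B\<close> absorbs the right inverse:
  \<open>B = B * (A * C) = (B * A) * C = C\<close>. The same computation gives the uniqueness that
  the \<open>THE\<close> in \<open>mat_inv\<close> asks for.\<close>

lemma mat_inv_eqI:
  fixes A :: "'a :: ring_1 mat"
  assumes A: "A \<in> carrier_mat n n" and inv: "invertible_mat A"
    and C: "C \<in> carrier_mat n n" and AC: "A * C = 1\<^sub>m n"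
  shows "mat_inv A = C"
proof -
  have uniq: "B = C" if "inverts_mat A B" "inverts_mat B A" for B
  proof -
    note B = inverts_mat_carrier[OF A that]
    have "B = B * (A * C)"
      using B AC by simp
    also have "\<dots> = (B * A) * C"
      using A B(1) C by (simp add: assoc_mult_mat[of _ n n _ n _ n])
    finally show "B = C"
      using B C by simp
  qed
  obtain B where "inverts_mat A B" "inverts_mat B A"
    using inv unfolding invertible_mat_def by blast
  then show ?thesis
    unfolding mat_inv_def using uniq by (intro the_equality) auto
qed

lemma mat_inv_carrier:
  fixes A :: "'a :: ring_1 mat"
  assumes A: "A \<in> carrier_mat n n" and inv: "invertible_mat A"
  shows "mat_inv A \<in> carrier_mat n n" "A * mat_inv A = 1\<^sub>m n" "mat_inv A * A = 1\<^sub>m n"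
  using inv mat_inv_eqI[OF A inv] unfolding invertible_mat_iff[OF A] by auto

lemma mult_eq_0_invertible:
  fixes A :: "'a :: ring_1 mat"
  assumes A: "A \<in> carrier_mat n n" and inv: "invertible_mat A"
    and Z: "Z \<in> carrier_mat n c" and AZ: "A * Z = 0\<^sub>m n c"
  shows "Z = 0\<^sub>m n c"
proof -
  note B = mat_inv_carrier[OF A inv]
  have "Z = (mat_inv A * A) * Z"
    using B Z by simp
  also have "\<dots> = mat_inv A * (A * Z)"
    using A B(1) Z by (simp add: assoc_mult_mat[of _ n n _ n _ c])
  finally show ?thesis
    using AZ B(1) by simp
qed

lemma diagonal_mat_inverse:
  fixes D :: "'a :: division_ring mat"
  assumes D: "D \<in> carrier_mat n n" "diagonal_mat D" and nz: "\<forall>k<n. D $$ (k, k) \<noteq> 0"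
  shows "invertible_mat D"
    and "mat_inv D = mat n n (\<lambda>(k, l). if k = l then inverse (D $$ (k, k)) else 0)"
proof -
  let ?E = "mat n n (\<lambda>(k, l). if k = l then inverse (D $$ (k, k)) else 0)"
  have DE: "D * ?E = 1\<^sub>m n"
  proof (rule eq_matI)
    fix k l assume "k < dim_row (1\<^sub>m n :: 'a mat)" "l < dim_col (1\<^sub>m n :: 'a mat)"
    then have kl: "k < n" "l < n" by auto
    have "(D * ?E) $$ (k, l) = (\<Sum>r<n. D $$ (k, r) * ?E $$ (r, l))"
      using D kl by (intro index_mult_mat_sum) auto
    also have "\<dots> = (\<Sum>r<n. if r = k then D $$ (k, k) * ?E $$ (k, l) else 0)"
      using kl D by (intro sum.cong) (auto simp: diagonal_mat_def)
    finally show "(D * ?E) $$ (k, l) = 1\<^sub>m n $$ (k, l)"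
      using kl nz by simp
  qed (use D in auto)
  \<comment> \<open>\<open>mat_inv_eqI\<close> presupposes invertibility, which is part of the
    conclusion here; hence both products are computed.\<close>
  have ED: "?E * D = 1\<^sub>m n"
  proof (rule eq_matI)
    fix k l assume "k < dim_row (1\<^sub>m n :: 'a mat)" "l < dim_col (1\<^sub>m n :: 'a mat)"
    then have kl: "k < n" "l < n" by auto
    have "(?E * D) $$ (k, l) = (\<Sum>r<n. ?E $$ (k, r) * D $$ (r, l))"
      using D kl by (intro index_mult_mat_sum) auto
    also have "\<dots> = (\<Sum>r<n. if r = k then ?E $$ (k, k) * D $$ (k, l) else 0)"
      using kl by (intro sum.cong) auto
    finally show "(?E * D) $$ (k, l) = 1\<^sub>m n $$ (k, l)"
      using kl nz D by (cases "k = l") (simp_all add: diagonal_mat_def)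
  qed (use D in auto)
  show inv: "invertible_mat D"
    unfolding invertible_mat_iff[OF D(1)] using DE ED by (intro bexI[of _ ?E]) auto
  show "mat_inv D = ?E"
    using mat_inv_eqI[OF D(1) inv _ DE] by simp
qed

section \<open>Simultaneous permutation of rows and columns\<close>

text \<open>This is P B P^T for the permutation matrix P of \<open>p\<close>, given by entries so
  that comparisons of matrices become index computations.\<close>

definition reindex_mat :: "nat \<Rightarrow> (nat \<Rightarrow> nat) \<Rightarrow> 'a mat \<Rightarrow> 'a mat" where
  "reindex_mat n p B = mat n n (\<lambda>(k, l). B $$ (p k, p l))"

lemma reindex_mat_carrier [simp]: "reindex_mat n p B \<in> carrier_mat n n"
  by (simp add: reindex_mat_def)

lemma perm_mat_carrier [simp]: "perm_mat n p \<in> carrier_mat n n"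
  by (simp add: perm_mat_def)

lemma perm_mat_mult_vec:
  fixes w :: "'a :: semiring_1 vec"
  assumes "w \<in> carrier_vec n" "\<forall>k<n. p k < n"
  shows "perm_mat n p *\<^sub>v w = vec n (\<lambda>k. w $ p k)"
proof (rule eq_vecI)
  fix k assume "k < dim_vec (vec n (\<lambda>k. w $ p k))"
  then have k: "k < n" by simp
  have "(perm_mat n p *\<^sub>v w) $ k = (\<Sum>r<n. perm_mat n p $$ (k, r) * w $ r)"
    using assms k by (auto simp: perm_mat_def scalar_prod_def lessThan_atLeast0 intro!: sum.cong)
  also have "\<dots> = (\<Sum>r<n. if r = p k then w $ p k else 0)"
    using k by (intro sum.cong) (auto simp: perm_mat_def)
  finally show "(perm_mat n p *\<^sub>v w) $ k = vec n (\<lambda>k. w $ p k) $ k"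
    using k assms by simp
qed (simp add: perm_mat_def)

lemma perm_mat_conj:
  fixes B :: "'a :: semiring_1 mat"
  assumes B: "B \<in> carrier_mat n n" and p: "\<forall>k<n. p k < n"
  shows "perm_mat n p * B * transpose_mat (perm_mat n p) = reindex_mat n p B"
proof (rule eq_matI)
  let ?P = "perm_mat n p :: 'a mat"
  fix k l assume "k < dim_row (reindex_mat n p B)" "l < dim_col (reindex_mat n p B)"
  then have kl: "k < n" "l < n" by (auto simp: reindex_mat_def)
  have PB: "(?P * B) $$ (k, r) = B $$ (p k, r)" if "r < n" for r
  proof -
    have "(?P * B) $$ (k, r) = (\<Sum>s<n. ?P $$ (k, s) * B $$ (s, r))"
      using B kl that by (intro index_mult_mat_sum) auto
    also have "\<dots> = (\<Sum>s<n. if s = p k then B $$ (p k, r) else 0)"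
      using kl by (intro sum.cong) (auto simp: perm_mat_def)
    finally show ?thesis using kl p by simp
  qed
  have "(?P * B * transpose_mat ?P) $$ (k, l) =
      (\<Sum>r<n. (?P * B) $$ (k, r) * transpose_mat ?P $$ (r, l))"
    using B kl by (intro index_mult_mat_sum) (auto intro!: mult_carrier_mat)
  also have "\<dots> = (\<Sum>r<n. if r = p l then B $$ (p k, p l) else 0)"
    using kl PB by (intro sum.cong) (auto simp: perm_mat_def)
  finally show "(?P * B * transpose_mat ?P) $$ (k, l) = reindex_mat n p B $$ (k, l)"
    using kl p by (simp add: reindex_mat_def)
qed (auto simp: perm_mat_def reindex_mat_def)

text \<open>Bracketing as P (Q B Q^T) P^T makes it two nested renumberings; the composed permutation
  never has to be determined.\<close>

lemma perm_mat_conj2: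
  fixes B :: "'a :: semiring_1 mat"
  assumes B: "B \<in> carrier_mat n n" and p: "\<forall>k<n. p k < n" and q: "\<forall>k<n. q k < n"
  shows "perm_mat n p * perm_mat n q * B * transpose_mat (perm_mat n q) *
    transpose_mat (perm_mat n p) = reindex_mat n p (reindex_mat n q B)"
proof -
  let ?P = "perm_mat n p :: 'a mat" and ?Q = "perm_mat n q :: 'a mat"
  have PQ: "?P \<in> carrier_mat n n" "?Q \<in> carrier_mat n n" "transpose_mat ?Q \<in> carrier_mat n n"
    by auto
  have "?P * ?Q * B * transpose_mat ?Q = ?P * (?Q * B) * transpose_mat ?Q"
    using assoc_mult_mat[OF PQ(1) PQ(2) B] by simp
  also have "\<dots> = ?P * (?Q * B * transpose_mat ?Q)"
    using assoc_mult_mat[OF PQ(1) mult_carrier_mat[OF PQ(2) B] PQ(3)] by simp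
  finally show ?thesis
    using perm_mat_conj[OF B q] perm_mat_conj[OF reindex_mat_carrier p] by simp
qed

text \<open>In the product the summation index runs through \<open>p r\<close> instead of
  \<open>r\<close>, which for a bijection gives the same sum.\<close>

lemma reindex_mat_mult:
  fixes A B :: "'a :: semiring_1 mat"
  assumes A: "A \<in> carrier_mat n n" and B: "B \<in> carrier_mat n n"
    and p: "bij_betw p {..<n} {..<n}"
  shows "reindex_mat n p A * reindex_mat n p B = reindex_mat n p (A * B)"
proof (rule eq_matI)
  fix k l assume "k < dim_row (reindex_mat n p (A * B))" "l < dim_col (reindex_mat n p (A * B))"
  then have kl: "k < n" "l < n" by (auto simp: reindex_mat_def)
  have pkl: "p k < n" "p l < n" using p kl by (auto dest: bij_betwE)
  have "(reindex_mat n p A * reindex_mat n p B) $$ (k, l) =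
      (\<Sum>r<n. reindex_mat n p A $$ (k, r) * reindex_mat n p B $$ (r, l))"
    using kl by (intro index_mult_mat_sum) auto
  also have "\<dots> = (\<Sum>r<n. A $$ (p k, p r) * B $$ (p r, p l))"
    using kl by (intro sum.cong) (auto simp: reindex_mat_def)
  also have "\<dots> = (\<Sum>r<n. A $$ (p k, r) * B $$ (r, p l))"
    by (rule sum.reindex_bij_betw[OF p])
  also have "\<dots> = (A * B) $$ (p k, p l)"
    using index_mult_mat_sum[OF A B pkl] by simp
  finally show "(reindex_mat n p A * reindex_mat n p B) $$ (k, l) =
      reindex_mat n p (A * B) $$ (k, l)"
    using kl by (simp add: reindex_mat_def)
qed (auto simp: reindex_mat_def)

lemma reindex_mat_one:
  assumes "bij_betw p {..<n} {..<n}"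
  shows "reindex_mat n p (1\<^sub>m n) = 1\<^sub>m n"
  using assms bij_betwE[OF assms]
  by (intro eq_matI) (auto simp: reindex_mat_def bij_betw_def dest: inj_onD)

lemma reindex_mat_invertible:
  fixes A :: "'a :: ring_1 mat"
  assumes A: "A \<in> carrier_mat n n" and p: "bij_betw p {..<n} {..<n}" and inv: "invertible_mat A"
  shows "invertible_mat (reindex_mat n p A)"
    and "mat_inv (reindex_mat n p A) = reindex_mat n p (mat_inv A)"
proof -
  note B = mat_inv_carrier[OF A inv]
  have 1: "reindex_mat n p A * reindex_mat n p (mat_inv A) = 1\<^sub>m n"
    "reindex_mat n p (mat_inv A) * reindex_mat n p A = 1\<^sub>m n"
    using reindex_mat_mult[OF A B(1) p] reindex_mat_mult[OF B(1) A p] B reindex_mat_one[OF p]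
    by auto
  show inv': "invertible_mat (reindex_mat n p A)"
    unfolding invertible_mat_iff[OF reindex_mat_carrier] using 1 by (blast intro: reindex_mat_carrier)
  show "mat_inv (reindex_mat n p A) = reindex_mat n p (mat_inv A)"
    using mat_inv_eqI[OF _ inv' _ 1(1)] by simp
qed

text \<open>Renumbering with the inverse permutation undoes \<open>p\<close>. This carries the
  non-singularity of the given matrix to the block matrix.\<close>

lemma invertible_reindex_matD:
  fixes A :: "'a :: ring_1 mat"
  assumes A: "A \<in> carrier_mat n n" and p: "bij_betw p {..<n} {..<n}"
    and inv: "invertible_mat (reindex_mat n p A)"
  shows "invertible_mat A"
proof -
  let ?q = "inv_into {..<n} p"
  have q: "bij_betw ?q {..<n} {..<n}"
    by (rule bij_betw_inv_into[OF p])
  have "reindex_mat n ?q (reindex_mat n p A) = A"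
    using A bij_betwE[OF q] bij_betw_inv_into_right[OF p]
    by (intro eq_matI) (auto simp: reindex_mat_def)
  then show ?thesis
    using reindex_mat_invertible(1)[OF reindex_mat_carrier q inv] by simp
qed

lemma tip_perm_less: "i < n \<Longrightarrow> \<forall>k<n. tip_perm n i k < n"
  unfolding tip_perm_def by presburger

text \<open>The inverse permutation sends the last index to the tip position \<open>i\<close> and
  every shaft index to its place \<open>shaft_pos i\<close>.\<close>

lemma bij_betw_tip_perm:
  assumes "i < n"
  shows "bij_betw (tip_perm n i) {..<n} {..<n}"
proof (rule bij_betw_byWitness[where f' = "\<lambda>k. if k = n - 1 then i else shaft_pos i k"])
  show "tip_perm n i ` {..<n} \<subseteq> {..<n}"
    using tip_perm_less[OF assms] by blast
  show "\<forall>k\<in>{..<n}. (if tip_perm n i k = n - 1 then i else shaft_pos i (tip_perm n i k)) = k"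
    "\<forall>k\<in>{..<n}. tip_perm n i (if k = n - 1 then i else shaft_pos i k) = k"
    using assms unfolding tip_perm_def shaft_pos_def Ball_def lessThan_iff by presburger+
  show "(\<lambda>k. if k = n - 1 then i else shaft_pos i k) ` {..<n} \<subseteq> {..<n}"
    using assms unfolding shaft_pos_def image_subset_iff Ball_def lessThan_iff by presburger
qed

lemma tip_perm_shaft_pos: "j < n - 1 \<Longrightarrow> tip_perm n i (shaft_pos i j) = j"
  by (simp add: tip_perm_def shaft_pos_def)

section \<open>Arrowhead matrices with the tip in the last position\<close>

lemma arrow_block_carrier:
  assumes "D \<in> carrier_mat m m"
  shows "arrow_block D u v \<alpha> \<in> carrier_mat (Suc m) (Suc m)"
  using assms by (auto simp: arrow_block_def mat_of_scalar_def)

lemma arrow_block_index: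
  assumes "D \<in> carrier_mat m m" "u \<in> carrier_vec m" "v \<in> carrier_vec m" "k \<le> m" "l \<le> m"
  shows "arrow_block D u v \<alpha> $$ (k, l) =
    (if k < m then if l < m then D $$ (k, l) else u $ k
     else if l < m then conjugate (v $ l) else \<alpha>)"
  using assms
  by (auto simp: arrow_block_def mat_of_scalar_def mat_of_col_def mat_of_row_def mat_of_cols_def
      index_mat_four_block)

text \<open>Shaft row k has at most the two nonzero entries d_k and u_k, so only the tip row of the
  product retains a sum. Every verification of an inverse rests on these two formulas.\<close>

lemma arrow_block_mult:
  fixes D X :: "'a :: {ring_1, conjugate} mat"
  assumes D: "D \<in> carrier_mat m m" "diagonal_mat D"
    and u: "u \<in> carrier_vec m" and v: "v \<in> carrier_vec m"
    and X: "X \<in> carrier_mat (Suc m) c" and l: "l < c"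
  shows "k < m \<Longrightarrow>
      (arrow_block D u v \<alpha> * X) $$ (k, l) = D $$ (k, k) * X $$ (k, l) + u $ k * X $$ (m, l)"
    and "(arrow_block D u v \<alpha> * X) $$ (m, l) =
      (\<Sum>r<m. conjugate (v $ r) * X $$ (r, l)) + \<alpha> * X $$ (m, l)"
proof -
  note M = arrow_block_carrier[OF D(1)] and ix = arrow_block_index[OF D(1) u v]
  have mult: "(arrow_block D u v \<alpha> * X) $$ (k, l) =
    (\<Sum>r<m. arrow_block D u v \<alpha> $$ (k, r) * X $$ (r, l)) +
      arrow_block D u v \<alpha> $$ (k, m) * X $$ (m, l)" if "k \<le> m" for k
    using index_mult_mat_sum[OF M X _ l] that by simp
  show "(arrow_block D u v \<alpha> * X) $$ (m, l) =
      (\<Sum>r<m. conjugate (v $ r) * X $$ (r, l)) + \<alpha> * X $$ (m, l)"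
    using mult[of m] by (simp add: ix)
  assume k: "k < m"
  have "(\<Sum>r<m. arrow_block D u v \<alpha> $$ (k, r) * X $$ (r, l)) =
      (\<Sum>r<m. if r = k then D $$ (k, k) * X $$ (k, l) else 0)"
    using k D by (intro sum.cong) (auto simp: ix diagonal_mat_def)
  then show "(arrow_block D u v \<alpha> * X) $$ (k, l) =
      D $$ (k, k) * X $$ (k, l) + u $ k * X $$ (m, l)"
    using mult[of k] k by (simp add: ix)
qed

text \<open>Triviality of the kernel in coordinates, with \<open>f m\<close> as the tip coordinate.
  An explicit kernel vector with a nonzero entry thus refutes a degenerate choice of
  coefficients.\<close>

lemma arrow_block_kernel:
  fixes D :: "'a :: {ring_1, conjugate} mat"
  assumes D: "D \<in> carrier_mat m m" "diagonal_mat D"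
    and u: "u \<in> carrier_vec m" and v: "v \<in> carrier_vec m"
    and inv: "invertible_mat (arrow_block D u v \<alpha>)"
    and shaft: "\<And>k. k < m \<Longrightarrow> D $$ (k, k) * f k + u $ k * f m = 0"
    and tip: "(\<Sum>r<m. conjugate (v $ r) * f r) + \<alpha> * f m = 0"
    and k: "k \<le> m"
  shows "f k = 0"
proof -
  let ?Z = "mat (Suc m) 1 (\<lambda>(k, _). f k)"
  note M = arrow_block_carrier[OF D(1), of u v \<alpha>]
  have Z: "?Z \<in> carrier_mat (Suc m) 1" by simp
  have "arrow_block D u v \<alpha> * ?Z = 0\<^sub>m (Suc m) 1"
  proof (rule eq_matI)
    fix k l assume "k < dim_row (0\<^sub>m (Suc m) 1 :: 'a mat)" "l < dim_col (0\<^sub>m (Suc m) 1 :: 'a mat)"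
    then have kl: "k < m \<or> k = m" "k < Suc m" "l < 1" by auto
    have "(arrow_block D u v \<alpha> * ?Z) $$ (k, l) = 0"
      using arrow_block_mult(1)[OF D u v Z kl(3), of k \<alpha>]
        arrow_block_mult(2)[OF D u v Z kl(3), of \<alpha>] shaft tip kl by auto
    then show "(arrow_block D u v \<alpha> * ?Z) $$ (k, l) = 0\<^sub>m (Suc m) 1 $$ (k, l)"
      using kl by simp
  qed (use M in auto)
  then have "?Z = 0\<^sub>m (Suc m) 1"
    by (rule mult_eq_0_invertible[OF M inv Z])
  then have "?Z $$ (k, 0) = 0"
    using k by simp
  then show ?thesis
    using k by simp
qed

section \<open>The inverse when the shaft has no zero\<close>

text \<open>The vector \<open>x\<close> solves the shaft rows with tip coordinate -1, and the tip
  row then gives M x = -\<sigma> e_m. So the rank-one term changes only the tip row of M \<Delta>,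
  where it cancels v^star D^{-1} and puts 1 in the corner. Here \<open>y\<close> lists the entries
  of y^star, already conjugated.\<close>

lemma arrow_block_inverse_regular:
  fixes D :: "'a :: {division_ring, conjugate} mat"
  assumes D: "D \<in> carrier_mat m m" "diagonal_mat D"
    and u: "u \<in> carrier_vec m" and v: "v \<in> carrier_vec m"
    and inv: "invertible_mat (arrow_block D u v \<alpha>)"
    and nz: "\<forall>k<m. D $$ (k, k) \<noteq> 0"
  defines "\<sigma> \<equiv> \<alpha> - (\<Sum>r<m. conjugate (v $ r) * (inverse (D $$ (r, r)) * u $ r))"
  defines "x \<equiv> \<lambda>k. if k < m then inverse (D $$ (k, k)) * u $ k else - 1"
  defines "y \<equiv> \<lambda>l. if l < m then conjugate (v $ l) * inverse (D $$ (l, l)) else - 1"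
  shows "\<sigma> \<noteq> 0"
    and "mat_inv (arrow_block D u v \<alpha>) = mat (Suc m) (Suc m)
      (\<lambda>(k, l). (if k = l \<and> k < m then inverse (D $$ (k, k)) else 0) + x k * inverse \<sigma> * y l)"
proof -
  note M = arrow_block_carrier[OF D(1), of u v \<alpha>]
  have vx: "(\<Sum>r<m. conjugate (v $ r) * x r) = \<alpha> - \<sigma>"
    by (simp add: \<sigma>_def x_def)
  have dx: "D $$ (k, k) * x k = u $ k" if "k < m" for k
    using nz that by (simp add: x_def mult.assoc[symmetric])
  have xm: "x m = - 1"
    by (simp add: x_def)
  show \<sigma>: "\<sigma> \<noteq> 0"
  proof
    \<comment> \<open>Then M x = 0, although the tip coordinate of \<open>x\<close> is -1.\<close>
    assume "\<sigma> = 0"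
    then have "x m = 0"
      using vx dx by (intro arrow_block_kernel[OF D u v inv, of x m]) (auto simp: xm)
    then show False
      by (simp add: xm)
  qed
  let ?\<Delta> = "\<lambda>k l. if k = l \<and> k < m then inverse (D $$ (k, k)) else 0"
  let ?X = "mat (Suc m) (Suc m) (\<lambda>(k, l). ?\<Delta> k l + x k * inverse \<sigma> * y l)"
  have X: "?X \<in> carrier_mat (Suc m) (Suc m)" by simp
  have "arrow_block D u v \<alpha> * ?X = 1\<^sub>m (Suc m)"
  proof (rule eq_matI)
    fix k l
    assume "k < dim_row (1\<^sub>m (Suc m) :: 'a mat)" "l < dim_col (1\<^sub>m (Suc m) :: 'a mat)"
    then have kl: "k < m \<or> k = m" "l < Suc m" by auto
    from kl(1) have "(arrow_block D u v \<alpha> * ?X) $$ (k, l) = (if k = l then 1 else 0)"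
    proof
      assume k: "k < m"
      have "(arrow_block D u v \<alpha> * ?X) $$ (k, l) =
          D $$ (k, k) * ?\<Delta> k l + D $$ (k, k) * x k * inverse \<sigma> * y l - u $ k * inverse \<sigma> * y l"
        unfolding arrow_block_mult(1)[OF D u v X kl(2) k]
        using k kl(2) by (simp add: xm algebra_simps)
      then show ?thesis
        using dx[OF k] nz k by auto
    next
      \<comment> \<open>The diagonal part contributes \<open>y l\<close> for \<open>l < m\<close>,
        and the rank-one part contributes \<open>- y l\<close> for every \<open>l\<close>; what
        survives is \<open>- y m = 1\<close> in the last column.\<close>
      assume k: "k = m"
      have "(arrow_block D u v \<alpha> * ?X) $$ (k, l) =
          (\<Sum>r<m. conjugate (v $ r) * (?\<Delta> r l + x r * inverse \<sigma> * y l)) - \<alpha> * inverse \<sigma> * y l"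
        unfolding k arrow_block_mult(2)[OF D u v X kl(2)]
        using kl(2) by (simp add: xm algebra_simps)
      also have "(\<Sum>r<m. conjugate (v $ r) * (?\<Delta> r l + x r * inverse \<sigma> * y l)) =
          (\<Sum>r<m. conjugate (v $ r) * ?\<Delta> r l) + (\<Sum>r<m. conjugate (v $ r) * x r) * inverse \<sigma> * y l"
        by (simp add: distrib_left sum.distrib sum_distrib_right mult.assoc)
      also have "(\<Sum>r<m. conjugate (v $ r) * ?\<Delta> r l) =
          (\<Sum>r<m. if r = l then conjugate (v $ l) * inverse (D $$ (l, l)) else 0)"
        by (intro sum.cong) auto
      also have "\<dots> = (if l < m then y l else 0)"
        by (simp add: y_def)
      also have "(\<Sum>r<m. conjugate (v $ r) * x r) * inverse \<sigma> * y l =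
          \<alpha> * inverse \<sigma> * y l - y l"
        using \<sigma> by (simp add: vx left_diff_distrib)
      finally show ?thesis
        using k kl(2) by (auto simp: y_def)
    qed
    then show "(arrow_block D u v \<alpha> * ?X) $$ (k, l) = 1\<^sub>m (Suc m) $$ (k, l)"
      using kl by auto
  qed (use M in auto)
  then show "mat_inv (arrow_block D u v \<alpha>) = ?X"
    by (rule mat_inv_eqI[OF M inv X])
qed

section \<open>The inverse when the shaft has a zero\<close>

text \<open>With d_j = 0, a vanishing u_j would make row j zero, and a vanishing v_j would put the
  unit vector e_j into the kernel. A second zero d_k would leave columns j and k with entries in the
  tip row only, hence dependent.\<close>

lemma arrow_block_zero_shaft:
  fixes D :: "'a :: real_complex_quat mat"
  assumes D: "D \<in> carrier_mat m m" "diagonal_mat D"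
    and u: "u \<in> carrier_vec m" and v: "v \<in> carrier_vec m"
    and inv: "invertible_mat (arrow_block D u v \<alpha>)"
    and j: "j < m" "D $$ (j, j) = 0"
  shows "u $ j \<noteq> 0" "v $ j \<noteq> 0" "\<And>k. k < m \<Longrightarrow> k \<noteq> j \<Longrightarrow> D $$ (k, k) \<noteq> 0"
proof -
  note M = arrow_block_carrier[OF D(1), of u v \<alpha>]
  note B = mat_inv_carrier[OF M inv]
  show "u $ j \<noteq> 0"
    using arrow_block_mult(1)[OF D u v B(1) _ j(1), of j \<alpha>] B(2) j by auto
  show vj: "v $ j \<noteq> 0"
  proof
    assume "v $ j = 0"
    then have "(if j = j then 1 else 0 :: 'a) = 0"
      using j by (intro arrow_block_kernel[OF D u v inv, of "\<lambda>k. if k = j then 1 else 0" j])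
        (auto simp: conjugate_0 intro!: sum.neutral)
    then show False by simp
  qed
  fix k assume k: "k < m" "k \<noteq> j"
  show "D $$ (k, k) \<noteq> 0"
  proof
    assume dk: "D $$ (k, k) = 0"
    \<comment> \<open>Chosen so that column k minus column j times \<open>?c\<close> (scalar on the
      right) vanishes also in the tip row.\<close>
    let ?c = "inverse (conjugate (v $ j)) * conjugate (v $ k)"
    let ?f = "\<lambda>r. if r = k then 1 else if r = j then - ?c else 0"
    have "(\<Sum>r<m. conjugate (v $ r) * ?f r) = (\<Sum>r\<in>{k, j}. conjugate (v $ r) * ?f r)"
      using k j by (intro sum.mono_neutral_right) auto
    also have "\<dots> = 0"
      using k vj by (simp add: mult.assoc[symmetric] conjugate_eq_0)
    finally have "?f k = 0"
      using k j dk by (intro arrow_block_kernel[OF D u v inv, of ?f k]) auto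
    then show False by simp
  qed
qed

text \<open>
  The inverse in the singular case, in the numbering of the arrowhead matrix itself. As
  \<open>inverse 0 = 0\<close>, the \<open>j\<close>-th summand of \<open>s\<close> and the first two terms of row \<open>j\<close> vanish.
\<close>

lemma arrow_block_inverse_singular:
  fixes D :: "'a :: real_complex_quat mat"
  assumes D: "D \<in> carrier_mat m m" "diagonal_mat D"
    and u: "u \<in> carrier_vec m" and v: "v \<in> carrier_vec m"
    and inv: "invertible_mat (arrow_block D u v \<alpha>)"
    and j: "j < m" "D $$ (j, j) = 0"
  defines "s \<equiv> \<Sum>r<m. conjugate (v $ r) * (inverse (D $$ (r, r)) * u $ r)"
  defines "c \<equiv> inverse (conjugate (v $ j))"
  shows "mat_inv (arrow_block D u v \<alpha>) = mat (Suc m) (Suc m)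
    (\<lambda>(k, l).
      if k < m then
        (if k = l then inverse (D $$ (k, k)) else 0)
        - (if l = j then inverse (D $$ (k, k)) * u $ k * inverse (u $ j) else 0)
        + (if k = j then
             if l = j then c * (- \<alpha> + s) * inverse (u $ j)
             else if l = m then c else - (c * conjugate (v $ l) * inverse (D $$ (l, l)))
           else 0)
      else if l = j then inverse (u $ j) else 0)"
    (is "_ = mat _ _ (\<lambda>(k, l). if k < m then ?a k l - ?b k l + ?r k l else ?t l)")
proof -
  note M = arrow_block_carrier[OF D(1), of u v \<alpha>]
  note nz = arrow_block_zero_shaft[OF D u v inv j]
  have cv: "conjugate (v $ j) * c = 1"
    using nz by (simp add: c_def conjugate_eq_0)
  let ?X = "mat (Suc m) (Suc m) (\<lambda>(k, l). if k < m then ?a k l - ?b k l + ?r k l else ?t l)"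
  have X: "?X \<in> carrier_mat (Suc m) (Suc m)" by simp
  have "arrow_block D u v \<alpha> * ?X = 1\<^sub>m (Suc m)"
  proof (rule eq_matI)
    fix k l
    assume "k < dim_row (1\<^sub>m (Suc m) :: 'a mat)" "l < dim_col (1\<^sub>m (Suc m) :: 'a mat)"
    then have kl: "k < m \<or> k = m" "l < Suc m" by auto
    from kl(1) have "(arrow_block D u v \<alpha> * ?X) $$ (k, l) = (if k = l then 1 else 0)"
    proof
      assume k: "k < m"
      have "(arrow_block D u v \<alpha> * ?X) $$ (k, l) =
          D $$ (k, k) * (?a k l - ?b k l + ?r k l) + u $ k * ?t l"
        unfolding arrow_block_mult(1)[OF D u v X kl(2) k]
        using k kl(2) by simp
      \<comment> \<open>For \<open>k = j\<close> the shaft coefficient is 0 and only u_j times the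
        last row of \<open>?X\<close> remains. For other \<open>k\<close> the term \<open>?b\<close>
        is there to cancel u_k u_j^{-1} in column j.\<close>
      also have "\<dots> = (if k = l then 1 else 0)"
        using nz(1,2) nz(3)[OF k] j
        by (cases "k = j") (auto simp: right_diff_distrib mult.assoc[symmetric])
      finally show ?thesis .
    next
      \<comment> \<open>The shaft rows leave row j of \<open>?X\<close> free, its coefficient d_j
        being 0. Its entries \<open>?r\<close> are what the tip row demands after division by the
        conjugate of v_j, whence the left factor \<open>c\<close>.\<close>
      assume k: "k = m"
      have "(arrow_block D u v \<alpha> * ?X) $$ (k, l) =
          (\<Sum>r<m. conjugate (v $ r) * (?a r l - ?b r l + ?r r l)) + \<alpha> * ?t l"
        unfolding k arrow_block_mult(2)[OF D u v X kl(2)]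
        using kl(2) by simp
      also have "(\<Sum>r<m. conjugate (v $ r) * (?a r l - ?b r l + ?r r l)) =
          (\<Sum>r<m. conjugate (v $ r) * ?a r l) - (\<Sum>r<m. conjugate (v $ r) * ?b r l)
          + (\<Sum>r<m. conjugate (v $ r) * ?r r l)"
        by (simp only: distrib_left right_diff_distrib sum.distrib sum_subtractf)
      also have "(\<Sum>r<m. conjugate (v $ r) * ?a r l) =
          (\<Sum>r<m. if r = l then conjugate (v $ l) * inverse (D $$ (l, l)) else 0)"
        by (intro sum.cong) auto
      also have "\<dots> = (if l < m then conjugate (v $ l) * inverse (D $$ (l, l)) else 0)"
        by simp
      also have "(\<Sum>r<m. conjugate (v $ r) * ?b r l) = (if l = j then s * inverse (u $ j) else 0)"
        by (simp add: s_def sum_distrib_right mult.assoc)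
      also have "(\<Sum>r<m. conjugate (v $ r) * ?r r l) =
          (\<Sum>r<m. if r = j then conjugate (v $ j) * ?r j l else 0)"
        by (intro sum.cong) auto
      also have "\<dots> = conjugate (v $ j) * ?r j l"
        using j by simp
      also have "\<dots> = (if l = j then (- \<alpha> + s) * inverse (u $ j)
          else if l = m then 1 else - (conjugate (v $ l) * inverse (D $$ (l, l))))"
        using cv by (simp add: mult.assoc[symmetric])
      finally show ?thesis
        using k kl(2) j by (cases "l = j"; cases "l = m") (simp_all add: algebra_simps)
    qed
    then show "(arrow_block D u v \<alpha> * ?X) $$ (k, l) = 1\<^sub>m (Suc m) $$ (k, l)"
      using kl by auto
  qed (use M in auto)
  then show "mat_inv (arrow_block D u v \<alpha>) = ?X"
    by (rule mat_inv_eqI[OF M inv X])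
qed

section \<open>Arrowhead matrices with the tip at an arbitrary position\<close>

lemma arrow_mat_eq_reindex_mat:
  fixes D :: "'a :: {semiring_1, conjugate} mat"
  assumes "D \<in> carrier_mat m m" "i < Suc m"
  shows "arrow_mat (Suc m) i D u v \<alpha> = reindex_mat (Suc m) (tip_perm (Suc m) i) (arrow_block D u v \<alpha>)"
  unfolding arrow_mat_def using assms by (intro perm_mat_conj arrow_block_carrier tip_perm_less)

lemma arrowhead_with_tipI:
  fixes X :: "'a :: {semiring_1, conjugate} mat"
  assumes t: "t < n" and X: "X \<in> carrier_mat n n"
    and zero: "\<And>k l. k < n \<Longrightarrow> l < n \<Longrightarrow> k \<noteq> l \<Longrightarrow> k \<noteq> t \<Longrightarrow> l \<noteq> t \<Longrightarrow> X $$ (k, l) = 0"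
  shows "arrowhead_with_tip n t X"
proof -
  obtain m where n: "n = Suc m"
    using t by (cases n) auto
  let ?s = "shaft_pos t"
  let ?D = "mat m m (\<lambda>(k, l). X $$ (?s k, ?s l))"
  \<comment> \<open>\<open>arrow_block\<close> conjugates its row vector, so row \<open>t\<close> of
    \<open>X\<close> is conjugated in advance.\<close>
  let ?u = "vec m (\<lambda>k. X $$ (?s k, t))" and ?v = "vec m (\<lambda>l. conjugate (X $$ (t, ?s l)))"
  have s: "?s k < n" "?s k \<noteq> t" "k \<noteq> l \<Longrightarrow> ?s k \<noteq> ?s l" if "k < m" for k l
    using that n unfolding shaft_pos_def by presburger+
  have D: "?D \<in> carrier_mat m m" "diagonal_mat ?D"
    using s zero by (auto simp: diagonal_mat_def)
  have tp: "tip_perm (Suc m) t k < m \<and> ?s (tip_perm (Suc m) t k) = k"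
    if "k < n" "k \<noteq> t" for k
    using that n t unfolding tip_perm_def shaft_pos_def by presburger
  have tt: "tip_perm (Suc m) t t = m"
    by (simp add: tip_perm_def)
  have "X = arrow_mat n t ?D ?u ?v (X $$ (t, t))"
  proof (rule eq_matI)
    fix k l
    assume "k < dim_row (arrow_mat n t ?D ?u ?v (X $$ (t, t)))"
      "l < dim_col (arrow_mat n t ?D ?u ?v (X $$ (t, t)))"
    then have kl: "k < n" "l < n"
      by (auto simp: arrow_mat_def perm_mat_def)
    have le: "tip_perm (Suc m) t k \<le> m" "tip_perm (Suc m) t l \<le> m"
      using tip_perm_less[of t "Suc m"] kl t n by (auto simp: less_Suc_eq_le)
    have "arrow_mat n t ?D ?u ?v (X $$ (t, t)) $$ (k, l) =
        arrow_block ?D ?u ?v (X $$ (t, t)) $$ (tip_perm (Suc m) t k, tip_perm (Suc m) t l)"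
      using kl t D(1) unfolding n by (simp add: arrow_mat_eq_reindex_mat reindex_mat_def)
    also have "\<dots> = X $$ (k, l)"
      using tp[of k] tp[of l] tt kl
      by (subst arrow_block_index[OF D(1) _ _ le]) (auto, (cases "k = t"; cases "l = t"; auto)+)
    finally show "X $$ (k, l) = arrow_mat n t ?D ?u ?v (X $$ (t, t)) $$ (k, l)" ..
  qed (use X in \<open>auto simp: arrow_mat_def perm_mat_def\<close>)
  then show ?thesis
    unfolding arrowhead_with_tip_def using t D n
    by (intro conjI exI[of _ ?D] exI[of _ ?u] exI[of _ ?v] exI[of _ "X $$ (t, t)"]) auto
qed

section \<open>Entries of the vectors, rank-one products and diagonal blocks\<close>

lemma diagonal_mult_vec:
  fixes w :: "'a :: semiring_0 vec"
  assumes "w \<in> carrier_vec n"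
  shows "mat n n (\<lambda>(k, l). if k = l then f k else 0) *\<^sub>v w = vec n (\<lambda>k. f k * w $ k)"
proof (rule eq_vecI)
  fix k assume "k < dim_vec (vec n (\<lambda>k. f k * w $ k))"
  then have k: "k < n" by simp
  have "(mat n n (\<lambda>(k, l). if k = l then f k else 0) *\<^sub>v w) $ k =
      (\<Sum>r<n. (if k = r then f k else 0) * w $ r)"
    using assms k by (simp add: scalar_prod_def lessThan_atLeast0)
  also have "\<dots> = (\<Sum>r<n. if r = k then f k * w $ k else 0)"
    by (intro sum.cong) auto
  finally show "(mat n n (\<lambda>(k, l). if k = l then f k else 0) *\<^sub>v w) $ k = vec n (\<lambda>k. f k * w $ k) $ k"
    using k by simp
qed simp

lemma diagonal_inverse_mult_vec:
  fixes D :: "'a :: real_complex_quat mat"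
  assumes D: "D \<in> carrier_mat n n" "diagonal_mat D" "\<forall>k<n. D $$ (k, k) \<noteq> 0"
    and w: "w \<in> carrier_vec n"
  shows "mat_inv D *\<^sub>v w = vec n (\<lambda>k. inverse (D $$ (k, k)) * w $ k)"
    and "mat_star (mat_inv D) *\<^sub>v w = vec n (\<lambda>k. inverse (conjugate (D $$ (k, k))) * w $ k)"
proof -
  show "mat_inv D *\<^sub>v w = vec n (\<lambda>k. inverse (D $$ (k, k)) * w $ k)"
    using diagonal_mult_vec[OF w, of "\<lambda>k. inverse (D $$ (k, k))"]
    unfolding diagonal_mat_inverse(2)[OF D] by simp
  have "mat_star (mat_inv D) =
      mat n n (\<lambda>(k, l). if k = l then inverse (conjugate (D $$ (k, k))) else 0)"
    unfolding diagonal_mat_inverse(2)[OF D] mat_star_def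
    by (rule eq_matI) (auto simp: conjugate_simps)
  then show "mat_star (mat_inv D) *\<^sub>v w = vec n (\<lambda>k. inverse (conjugate (D $$ (k, k))) * w $ k)"
    using diagonal_mult_vec[OF w, of "\<lambda>k. inverse (conjugate (D $$ (k, k)))"] by simp
qed

lemma conjugate_scalar_prod_vec:
  fixes w :: "'a :: {semiring_0, conjugate} vec"
  shows "conjugate w \<bullet> vec n g = (\<Sum>r<n. conjugate w $ r * g r)"
  by (auto simp: scalar_prod_def lessThan_atLeast0 intro!: sum.cong)

lemma rank_one_carrier:
  "mat_of_col x * mat_of_scalar c * mat_of_row y \<in> carrier_mat (dim_vec x) (dim_vec y)"
  by (auto simp: mat_of_col_def mat_of_scalar_def)

lemma rank_one_index:
  fixes x y :: "'a :: semiring_0 vec"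
  assumes "k < dim_vec x" "l < dim_vec y"
  shows "(mat_of_col x * mat_of_scalar c * mat_of_row y) $$ (k, l) = x $ k * c * y $ l"
proof -
  have c: "mat_of_col x \<in> carrier_mat (dim_vec x) 1" "mat_of_scalar c \<in> carrier_mat 1 1"
    "mat_of_row y \<in> carrier_mat 1 (dim_vec y)"
    by (auto simp: mat_of_col_def mat_of_scalar_def)
  have "(mat_of_col x * mat_of_scalar c * mat_of_row y) $$ (k, l) =
      (\<Sum>r<1. (mat_of_col x * mat_of_scalar c) $$ (k, r) * mat_of_row y $$ (r, l))"
    using c assms by (intro index_mult_mat_sum) auto
  also have "\<dots> = (\<Sum>r<1. (\<Sum>s<1. mat_of_col x $$ (k, s) * mat_of_scalar c $$ (s, r)) *
      mat_of_row y $$ (r, l))"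
    using c assms by (intro sum.cong refl arg_cong2[where f = "(*)"] index_mult_mat_sum) auto
  also have "\<dots> = x $ k * c * y $ l"
    using assms by (simp add: mat_of_col_def mat_of_scalar_def mat_of_row_def mat_of_cols_def)
  finally show ?thesis .
qed

text \<open>Cuts out the index of the zero shaft element; the two outer sums become the scalar
  products belonging to the blocks on either side of it.\<close>

lemma sum_lessThan_split:
  fixes f :: "nat \<Rightarrow> 'a :: comm_monoid_add"
  shows "(\<Sum>r<j + Suc q. f r) = (\<Sum>r<j. f r) + f j + (\<Sum>r<q. f (j + Suc r))"
  by (induction q) (auto simp: add.assoc)

text \<open>The three sizes are arbitrary because the zero block of order 1 stands in the middle of
  \<open>D\<close> but at the end of \<open>D'\<close>.\<close>

lemma diag_block_mat3_index:
  assumes "D1 \<in> carrier_mat a a" "D2 \<in> carrier_mat b b" "D3 \<in> carrier_mat c c"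
    and "k < a + b + c" "l < a + b + c"
  shows "diag_block_mat [D1, D2, D3] $$ (k, l) =
    (if k < a \<and> l < a then D1 $$ (k, l)
     else if a \<le> k \<and> k < a + b \<and> a \<le> l \<and> l < a + b then D2 $$ (k - a, l - a)
     else if a + b \<le> k \<and> a + b \<le> l then D3 $$ (k - a - b, l - a - b) else 0)"
  using assms by (auto simp: Let_def)

lemma diag_block_mat3_carrier:
  assumes "D1 \<in> carrier_mat a a" "D2 \<in> carrier_mat b b" "D3 \<in> carrier_mat c c"
  shows "diag_block_mat [D1, D2, D3] \<in> carrier_mat (a + b + c) (a + b + c)"
  using assms by (auto simp: Let_def)

text \<open>Writing a larger index as \<open>j + Suc r\<close> exhibits the index \<open>r\<close>
  inside the second block, so the truncated subtractions evaluate.\<close>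

lemma index_cases:
  fixes k j :: nat
  obtains (less) "k < j" | (eq) "k = j" | (greater) r where "k = j + Suc r"
  by (metis less_imp_Suc_add add_Suc_right linorder_less_linear)

section \<open>The partitioned form of the inverse\<close>

text \<open>Moving index \<open>j\<close> to the end in the entry formula for the inverse leaves the
  two blocks, followed by the former tip, in their old order. The former tip thereby becomes the
  last shaft element, which is 0.\<close>

lemma arrow_block_inverse_partition:
  fixes D1 D2 :: "'a :: real_complex_quat mat"
  assumes D1: "D1 \<in> carrier_mat j j" and D2: "D2 \<in> carrier_mat q q"
    and u1: "u1 \<in> carrier_vec j" and u2: "u2 \<in> carrier_vec q"
    and v1: "v1 \<in> carrier_vec j" and v2: "v2 \<in> carrier_vec q"
    and D: "D = diag_block_mat [D1, 0\<^sub>m 1 1, D2]" and diag: "diagonal_mat D"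
    and u: "u = u1 @\<^sub>v vec_of_list [uj] @\<^sub>v u2"
    and v: "v = v1 @\<^sub>v vec_of_list [vj] @\<^sub>v v2"
    and inv: "invertible_mat (arrow_block D u v \<alpha>)"
  defines "D' \<equiv> diag_block_mat [mat_inv D1, mat_inv D2, 0\<^sub>m 1 1]"
    and "u' \<equiv> vec_mult_right
        (- (mat_inv D1 *\<^sub>v u1) @\<^sub>v - (mat_inv D2 *\<^sub>v u2) @\<^sub>v vec_of_list [1]) (inverse uj)"
    and "v' \<equiv> vec_mult_right
        (- (mat_star (mat_inv D1) *\<^sub>v v1) @\<^sub>v - (mat_star (mat_inv D2) *\<^sub>v v2) @\<^sub>v vec_of_list [1])
        (inverse vj)"
    and "\<alpha>' \<equiv> conjugate (inverse vj) *
        (- \<alpha> + conjugate v1 \<bullet> (mat_inv D1 *\<^sub>v u1) + conjugate v2 \<bullet> (mat_inv D2 *\<^sub>v u2)) *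
        inverse uj"
    and "n \<equiv> Suc (j + Suc q)"
  shows "invertible_mat D1" "invertible_mat D2" "uj \<noteq> 0" "vj \<noteq> 0"
    and "arrow_block D' u' v' \<alpha>' \<in> carrier_mat n n"
    and "mat_inv (arrow_block D u v \<alpha>) =
      reindex_mat n (tip_perm n j) (arrow_block D' u' v' \<alpha>')"
proof -
  let ?m = "j + Suc q"
  have Dc: "D \<in> carrier_mat ?m ?m"
    using diag_block_mat3_carrier[OF D1 _ D2, of "0\<^sub>m 1 1" 1] by (simp add: D)
  have uc: "u \<in> carrier_vec ?m" and vc: "v \<in> carrier_vec ?m"
    by (intro carrier_vecI, simp add: u v carrier_vecD[OF u1] carrier_vecD[OF u2]
        carrier_vecD[OF v1] carrier_vecD[OF v2])+
  have Dix: "D $$ (k, l) = (if k < j \<and> l < j then D1 $$ (k, l)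
      else if j < k \<and> j < l then D2 $$ (k - Suc j, l - Suc j) else 0)" if "k < ?m" "l < ?m" for k l
    using diag_block_mat3_index[OF D1 _ D2, of "0\<^sub>m 1 1" 1 k l] that unfolding D
    by (cases k j rule: index_cases; cases l j rule: index_cases; simp)
  have uix: "u $ k = (if k < j then u1 $ k else if k = j then uj else u2 $ (k - Suc j))"
    and vix: "v $ k = (if k < j then v1 $ k else if k = j then vj else v2 $ (k - Suc j))"
    if "k < ?m" for k
    using that by (cases k j rule: index_cases; simp add: u v carrier_vecD[OF u1] carrier_vecD[OF u2]
        carrier_vecD[OF v1] carrier_vecD[OF v2])+
  have j: "j < ?m" "D $$ (j, j) = 0"
    by (auto simp: Dix)
  note nz = arrow_block_zero_shaft[OF Dc diag uc vc inv j]
  show uj: "uj \<noteq> 0" and vj: "vj \<noteq> 0"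
    using nz uix[of j] vix[of j] by auto
  have D1d: "diagonal_mat D1" "\<forall>k<j. D1 $$ (k, k) \<noteq> 0"
  proof -
    have "D1 $$ (k, l) = D $$ (k, l)" if "k < j" "l < j" for k l
      using that by (simp add: Dix)
    then show "diagonal_mat D1" "\<forall>k<j. D1 $$ (k, k) \<noteq> 0"
      using diag nz(3) D1 Dc by (auto simp: diagonal_mat_def)
  qed
  have D2d: "diagonal_mat D2" "\<forall>k<q. D2 $$ (k, k) \<noteq> 0"
  proof -
    have "D2 $$ (k, l) = D $$ (j + Suc k, j + Suc l)" if "k < q" "l < q" for k l
      using that by (simp add: Dix)
    then show "diagonal_mat D2" "\<forall>k<q. D2 $$ (k, k) \<noteq> 0"
      using diag nz(3) D2 Dc by (auto simp: diagonal_mat_def)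
  qed
  note i1 = diagonal_mat_inverse[OF D1 D1d] and i2 = diagonal_mat_inverse[OF D2 D2d]
  note w1 = diagonal_inverse_mult_vec[OF D1 D1d] and w2 = diagonal_inverse_mult_vec[OF D2 D2d]
  show "invertible_mat D1" "invertible_mat D2"
    by (fact i1 i2)+
  let ?s = "\<Sum>r<?m. conjugate (v $ r) * (inverse (D $$ (r, r)) * u $ r)"
  have "?s = conjugate v1 \<bullet> (mat_inv D1 *\<^sub>v u1) + conjugate v2 \<bullet> (mat_inv D2 *\<^sub>v u2)"
    unfolding sum_lessThan_split w1(1)[OF u1] w2(1)[OF u2] conjugate_scalar_prod_vec
    by (simp add: Dix uix vix carrier_vecD[OF v1] carrier_vecD[OF v2])
  then have \<alpha>': "\<alpha>' = inverse (conjugate vj) * (- \<alpha> + ?s) * inverse uj"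
    by (simp add: \<alpha>'_def conjugate_inverse add.assoc)
  have c1: "mat_inv D1 \<in> carrier_mat j j" "mat_inv D2 \<in> carrier_mat q q"
    by (simp_all add: i1 i2)
  have D'c: "D' \<in> carrier_mat ?m ?m"
    using diag_block_mat3_carrier[OF c1, of "0\<^sub>m 1 1" 1] by (simp add: D'_def)
  have u'c: "u' \<in> carrier_vec ?m" and v'c: "v' \<in> carrier_vec ?m"
    by (intro carrier_vecI, simp add: u'_def v'_def vec_mult_right_def w1[OF u1] w1[OF v1]
        w2[OF u2] w2[OF v2])+
  \<comment> \<open>The place of \<open>k\<close> once \<open>j\<close> is removed, as in
    \<open>tip_perm n j\<close> away from \<open>j\<close>. The former tip \<open>j + Suc q\<close>
    lands on \<open>j + q\<close>, the position of the final 0 in \<open>D'\<close>.\<close>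
  define g where "g = (\<lambda>k. if k < j then k else k - Suc 0)"
  have D'ix: "D' $$ (g k, g l) =
      (if k = l \<and> k < ?m then inverse (D $$ (k, k)) else 0)"
    if "k \<le> ?m" "l \<le> ?m" "k \<noteq> j" "l \<noteq> j" for k l
  proof -
    have "g k < j + q + 1" "g l < j + q + 1"
      using that unfolding g_def by presburger+
    from diag_block_mat3_index[OF c1 zero_carrier_mat this] show ?thesis
      unfolding D'_def i1 i2 using that
      by (cases k j rule: index_cases; cases l j rule: index_cases) (auto simp: g_def Dix)
  qed
  have u'ix: "u' $ (g k) =
      (if k < ?m then - (inverse (D $$ (k, k)) * u $ k * inverse uj) else inverse uj)"
    if "k \<le> ?m" "k \<noteq> j" for k
    using that by (cases k j rule: index_cases;
        simp add: g_def u'_def vec_mult_right_def w1[OF u1] w2[OF u2] Dix uix)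
  \<comment> \<open>Conjugation reverses the product, so the right factor \<open>inverse vj\<close>
    of \<open>v'\<close> becomes the left factor found in row j of the inverse.\<close>
  have v'ix: "conjugate (v' $ (g k)) = (if k < ?m
      then - (inverse (conjugate vj) * conjugate (v $ k) * inverse (D $$ (k, k)))
      else inverse (conjugate vj))"
    if "k \<le> ?m" "k \<noteq> j" for k
    using that by (cases k j rule: index_cases;
        simp add: g_def v'_def vec_mult_right_def w1[OF v1] w2[OF v2] Dix vix conjugate_simps
        mult.assoc)
  show B: "arrow_block D' u' v' \<alpha>' \<in> carrier_mat n n"
    unfolding n_def by (rule arrow_block_carrier[OF D'c])
  show "mat_inv (arrow_block D u v \<alpha>) =
      reindex_mat n (tip_perm n j) (arrow_block D' u' v' \<alpha>')"
  proof (rule eq_matI)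
    fix k l
    assume "k < dim_row (reindex_mat n (tip_perm n j) (arrow_block D' u' v' \<alpha>'))"
      "l < dim_col (reindex_mat n (tip_perm n j) (arrow_block D' u' v' \<alpha>'))"
    then have kl: "k \<le> ?m" "l \<le> ?m"
      by (auto simp: reindex_mat_def n_def)
    have tp: "tip_perm n j r = (if r = j then ?m else g r)" for r
      by (simp add: tip_perm_def n_def g_def)
    have g: "g r < ?m" if "r \<le> ?m" "r \<noteq> j" for r
      using that unfolding g_def by presburger
    have le: "tip_perm n j k \<le> ?m" "tip_perm n j l \<le> ?m"
      using kl unfolding tip_perm_def n_def by presburger+
    have "reindex_mat n (tip_perm n j) (arrow_block D' u' v' \<alpha>') $$ (k, l) =
        arrow_block D' u' v' \<alpha>' $$ (tip_perm n j k, tip_perm n j l)"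
      using kl by (simp add: reindex_mat_def n_def)
    also have "\<dots> =
      (if k \<noteq> j then if l \<noteq> j then D' $$ (g k, g l) else u' $ g k
       else if l \<noteq> j then conjugate (v' $ g l) else \<alpha>')"
      unfolding arrow_block_index[OF D'c u'c v'c le] using g[OF kl(1)] g[OF kl(2)]
      by (cases "k = j"; cases "l = j") (simp_all add: tp)
    also have "\<dots> = mat_inv (arrow_block D u v \<alpha>) $$ (k, l)"
      unfolding arrow_block_inverse_singular[OF Dc diag uc vc inv j]
      using kl D'ix[OF kl] u'ix[OF kl(1)] v'ix[OF kl(2)] j uix[of j] vix[of j]
      by (cases "k = j"; cases "l = j") (auto simp: \<alpha>')
    finally show "mat_inv (arrow_block D u v \<alpha>) $$ (k, l) =
        reindex_mat n (tip_perm n j) (arrow_block D' u' v' \<alpha>') $$ (k, l)" ..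
  qed (simp_all add: arrow_block_inverse_singular[OF Dc diag uc vc inv j] reindex_mat_def n_def)
qed

section \<open>Transfer from the block matrix to an arbitrary tip position\<close>

text \<open>\<open>inverse\<close> and \<open>mat_inv\<close> are total, so the formulas are
  accompanied by the claims that the diagonal blocks and scalars inverted in them are indeed
  invertible.\<close>

theorem lemma4:
  fixes n i :: nat
    and D A :: "'a :: real_complex_quat mat"
    and u v :: "'a vec"
    and \<alpha> :: 'a
  assumes i: "i < n"
    and D: "D \<in> carrier_mat (n - 1) (n - 1)" "diagonal_mat D"
    and u: "u \<in> carrier_vec (n - 1)"
    and v: "v \<in> carrier_vec (n - 1)"
    and A: "A = arrow_mat n i D u v \<alpha>"
    and nonsing: "invertible_mat A"
  shows
    "((\<forall>j < n - 1. D $$ (j, j) \<noteq> 0) \<longrightarrow>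
        (let P = perm_mat n (tip_perm n i);
             \<Delta> = P * four_block_mat (mat_inv D) (0\<^sub>m (n - 1) 1) (0\<^sub>m 1 (n - 1)) (0\<^sub>m 1 1)
                    * transpose_mat P;
             x = P *\<^sub>v ((mat_inv D *\<^sub>v u) @\<^sub>v vec_of_list [- 1]);
             y = P *\<^sub>v ((mat_star (mat_inv D) *\<^sub>v v) @\<^sub>v vec_of_list [- 1]);
             \<sigma> = \<alpha> - conjugate v \<bullet> (mat_inv D *\<^sub>v u);
             \<rho> = inverse \<sigma>
         in invertible_mat D \<and> \<sigma> \<noteq> 0 \<and> diagonal_mat \<Delta> \<and>
            mat_inv A = \<Delta> + mat_of_col x * mat_of_scalar \<rho> * mat_of_row (conjugate y))) \<and>
     (\<forall>j < n - 1. D $$ (j, j) = 0 \<longrightarrow>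
        arrowhead_with_tip n (shaft_pos i j) (mat_inv A) \<and> mat_inv A $$ (i, i) = 0 \<and>
        (\<forall>D1 D2 u1 u2 v1 v2 uj vj.
           D1 \<in> carrier_mat j j \<and> D2 \<in> carrier_mat (n - 2 - j) (n - 2 - j) \<and>
           u1 \<in> carrier_vec j \<and> u2 \<in> carrier_vec (n - 2 - j) \<and>
           v1 \<in> carrier_vec j \<and> v2 \<in> carrier_vec (n - 2 - j) \<and>
           D = diag_block_mat [D1, 0\<^sub>m 1 1, D2] \<and>
           u = u1 @\<^sub>v vec_of_list [uj] @\<^sub>v u2 \<and>
           v = v1 @\<^sub>v vec_of_list [vj] @\<^sub>v v2 \<longrightarrow>
           (let P = perm_mat n (tip_perm n i);
                P' = perm_mat n (tip_perm n j);
                D' = diag_block_mat [mat_inv D1, mat_inv D2, 0\<^sub>m 1 1];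
                u' = vec_mult_right
                       (- (mat_inv D1 *\<^sub>v u1) @\<^sub>v - (mat_inv D2 *\<^sub>v u2) @\<^sub>v vec_of_list [1])
                       (inverse uj);
                v' = vec_mult_right
                       (- (mat_star (mat_inv D1) *\<^sub>v v1) @\<^sub>v - (mat_star (mat_inv D2) *\<^sub>v v2)
                          @\<^sub>v vec_of_list [1])
                       (inverse vj);
                \<alpha>' = conjugate (inverse vj)
                       * (- \<alpha> + conjugate v1 \<bullet> (mat_inv D1 *\<^sub>v u1)
                              + conjugate v2 \<bullet> (mat_inv D2 *\<^sub>v u2))
                       * inverse uj
            in invertible_mat D1 \<and> invertible_mat D2 \<and> uj \<noteq> 0 \<and> vj \<noteq> 0 \<and>
               mat_inv A
                 = P * P' * arrow_block D' u' v' \<alpha>' * transpose_mat P' * transpose_mat P)))"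
proof -
  obtain m where n: "n = Suc m"
    using i by (cases n) auto
  let ?M = "arrow_block D u v \<alpha>" and ?p = "tip_perm n i"
  have Dc: "D \<in> carrier_mat m m" and uc: "u \<in> carrier_vec m" and vc: "v \<in> carrier_vec m"
    using D u v n by auto
  have M: "?M \<in> carrier_mat n n"
    unfolding n by (rule arrow_block_carrier[OF Dc])
  note p = bij_betw_tip_perm[OF i] and pl = tip_perm_less[OF i]
  have A': "A = reindex_mat n ?p ?M"
    using A i arrow_mat_eq_reindex_mat[OF Dc] by (simp add: n)
  have inv: "invertible_mat ?M"
    using nonsing unfolding A' by (rule invertible_reindex_matD[OF M p])
  have invA: "mat_inv A = reindex_mat n ?p (mat_inv ?M)"
    unfolding A' by (rule reindex_mat_invertible(2)[OF M p inv])
  have p_inj: "?p k = ?p l \<longleftrightarrow> k = l" if "k < n" "l < n" for k l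
    using p that by (auto simp: bij_betw_def dest: inj_onD)
  have regular: "let P = perm_mat n ?p;
        \<Delta> = P * four_block_mat (mat_inv D) (0\<^sub>m (n - 1) 1) (0\<^sub>m 1 (n - 1)) (0\<^sub>m 1 1) * transpose_mat P;
        x = P *\<^sub>v ((mat_inv D *\<^sub>v u) @\<^sub>v vec_of_list [- 1]);
        y = P *\<^sub>v ((mat_star (mat_inv D) *\<^sub>v v) @\<^sub>v vec_of_list [- 1]);
        \<sigma> = \<alpha> - conjugate v \<bullet> (mat_inv D *\<^sub>v u);
        \<rho> = inverse \<sigma>
      in invertible_mat D \<and> \<sigma> \<noteq> 0 \<and> diagonal_mat \<Delta> \<and>
         mat_inv A = \<Delta> + mat_of_col x * mat_of_scalar \<rho> * mat_of_row (conjugate y)"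
    if "\<forall>j < n - 1. D $$ (j, j) \<noteq> 0"
  proof -
    have nz: "\<forall>k<m. D $$ (k, k) \<noteq> 0"
      using that n by simp
    note iD = diagonal_mat_inverse[OF Dc D(2) nz] and w = diagonal_inverse_mult_vec[OF Dc D(2) nz]
    note reg = arrow_block_inverse_regular[OF Dc D(2) uc vc inv nz]
    define F where "F = four_block_mat (mat_inv D) (0\<^sub>m m 1) (0\<^sub>m 1 m) (0\<^sub>m 1 1)"
    define x0 where "x0 = (mat_inv D *\<^sub>v u) @\<^sub>v vec_of_list [- 1]"
    define y0 where "y0 = (mat_star (mat_inv D) *\<^sub>v v) @\<^sub>v vec_of_list [- 1]"
    define \<sigma> where "\<sigma> = \<alpha> - conjugate v \<bullet> (mat_inv D *\<^sub>v u)"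
    have F: "F \<in> carrier_mat n n"
      by (intro carrier_matI) (simp_all add: F_def iD n)
    have Fix: "F $$ (k, l) = (if k = l \<and> k < m then inverse (D $$ (k, k)) else 0)"
      if "k < n" "l < n" for k l
      using that by (auto simp: F_def iD n)
    have x0: "x0 \<in> carrier_vec n" and y0: "y0 \<in> carrier_vec n"
      by (intro carrier_vecI, simp add: x0_def y0_def w[OF uc] w[OF vc] n)+
    have x0ix: "x0 $ k = (if k < m then inverse (D $$ (k, k)) * u $ k else - 1)"
      and y0ix: "conjugate (y0 $ k) =
        (if k < m then conjugate (v $ k) * inverse (D $$ (k, k)) else - 1)" if "k < n" for k
      using that by (auto simp: x0_def y0_def w[OF uc] w[OF vc] n conjugate_simps)
    have \<sigma>: "\<sigma> = \<alpha> - (\<Sum>r<m. conjugate (v $ r) * (inverse (D $$ (r, r)) * u $ r))"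
      unfolding \<sigma>_def w(1)[OF uc] conjugate_scalar_prod_vec
      by (simp add: carrier_vecD[OF vc])
    note Px = perm_mat_mult_vec[OF x0 pl] and Py = perm_mat_mult_vec[OF y0 pl]
      and PF = perm_mat_conj[OF F pl]
    let ?R = "mat_of_col (perm_mat n ?p *\<^sub>v x0) * mat_of_scalar (inverse \<sigma>) *
      mat_of_row (conjugate (perm_mat n ?p *\<^sub>v y0))"
    note R = rank_one_carrier[of "perm_mat n ?p *\<^sub>v x0" "inverse \<sigma>"
        "conjugate (perm_mat n ?p *\<^sub>v y0)"]
    have "diagonal_mat (reindex_mat n ?p F)"
      using pl p_inj Fix by (auto simp: diagonal_mat_def reindex_mat_def)
    moreover have "mat_inv A = reindex_mat n ?p F + ?R"
    proof (rule eq_matI)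
      fix k l
      assume "k < dim_row (reindex_mat n ?p F + ?R)" "l < dim_col (reindex_mat n ?p F + ?R)"
      then have kl: "k < n" "l < n"
        using R by (auto simp: Px Py)
      have pkl: "?p k < n" "?p l < n"
        using pl kl by auto
      have "?R $$ (k, l) = x0 $ ?p k * inverse \<sigma> * conjugate (y0 $ ?p l)"
        using kl by (subst rank_one_index) (auto simp: Px Py)
      then have "(reindex_mat n ?p F + ?R) $$ (k, l) =
          F $$ (?p k, ?p l) + x0 $ ?p k * inverse \<sigma> * conjugate (y0 $ ?p l)"
        using kl R by (auto simp: Px Py reindex_mat_def)
      also have "\<dots> = mat_inv ?M $$ (?p k, ?p l)"
        using pkl unfolding reg(2) Fix[OF pkl] x0ix[OF pkl(1)] y0ix[OF pkl(2)] \<sigma>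
        by (simp add: n)
      also have "\<dots> = mat_inv A $$ (k, l)"
        using kl by (simp add: invA reindex_mat_def)
      finally show "mat_inv A $$ (k, l) = (reindex_mat n ?p F + ?R) $$ (k, l)" ..
    qed (use R in \<open>auto simp: Px Py invA reindex_mat_def\<close>)
    moreover have "\<sigma> \<noteq> 0"
      using reg(1) unfolding \<sigma> .
    moreover have n1: "n - 1 = m"
      by (simp add: n)
    ultimately show ?thesis
      using iD(1) PF unfolding Let_def n1 F_def x0_def y0_def \<sigma>_def by simp
  qed
  have singular: "arrowhead_with_tip n (shaft_pos i j) (mat_inv A) \<and> mat_inv A $$ (i, i) = 0"
    if j: "j < n - 1" "D $$ (j, j) = 0" for j
  proof -
    have jm: "j < m"
      using j n by simp
    note X = arrow_block_inverse_singular[OF Dc D(2) uc vc inv jm j(2)]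
    have t: "shaft_pos i j < n"
      using j(1) unfolding shaft_pos_def by presburger
    have pt: "?p (shaft_pos i j) = j"
      by (rule tip_perm_shaft_pos[OF j(1)])
    \<comment> \<open>In block numbering the inverse is diagonal outside row and column j, and j is
      the image of \<open>shaft_pos i j\<close> under \<open>?p\<close>.\<close>
    have "arrowhead_with_tip n (shaft_pos i j) (mat_inv A)"
    proof (rule arrowhead_with_tipI[OF t])
      fix k l
      assume kl: "k < n" "l < n" "k \<noteq> l" "k \<noteq> shaft_pos i j" "l \<noteq> shaft_pos i j"
      then have "?p k \<noteq> j" "?p l \<noteq> j" "?p k \<noteq> ?p l" "?p k < n" "?p l < n"
        using p_inj[of k "shaft_pos i j"] p_inj[of l "shaft_pos i j"] p_inj[of k l] pt t pl by auto
      then show "mat_inv A $$ (k, l) = 0"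
        using kl unfolding invA X by (simp add: reindex_mat_def n)
    qed (simp add: invA)
    \<comment> \<open>Position \<open>i\<close> corresponds to the last index of the block matrix;
      the last row of the inverse is zero outside column j, and \<open>j < m\<close>.\<close>
    moreover have "?p i = m"
      by (simp add: tip_perm_def n)
    then have "mat_inv A $$ (i, i) = 0"
      using i jm unfolding invA X by (simp add: reindex_mat_def n)
    ultimately show ?thesis ..
  qed
  show ?thesis
  proof (intro conjI impI allI, goal_cases)
    case 1
    then show ?case by (rule regular)
  next
    case (2 j)
    then show ?case using singular by blast
  next
    case (3 j)
    then show ?case using singular by blast
  next
    case (4 j D1 D2 u1 u2 v1 v2 uj vj)
    \<comment> \<open>Since \<open>j < n - 1\<close>, this subtraction is not truncated, and
      \<open>n\<close> is the sum of \<open>j\<close>, \<open>q\<close> and the two places for the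
      zero and the tip.\<close>
    define q where "q = n - 2 - j"
    have nq: "n = Suc (j + Suc q)" and q: "n - 2 - j = q"
      using 4(1) by (auto simp: q_def)
    have D1: "D1 \<in> carrier_mat j j" and D2: "D2 \<in> carrier_mat q q"
      and u1: "u1 \<in> carrier_vec j" and u2: "u2 \<in> carrier_vec q"
      and v1: "v1 \<in> carrier_vec j" and v2: "v2 \<in> carrier_vec q"
      and eq: "D = diag_block_mat [D1, 0\<^sub>m 1 1, D2]"
        "u = u1 @\<^sub>v vec_of_list [uj] @\<^sub>v u2" "v = v1 @\<^sub>v vec_of_list [vj] @\<^sub>v v2"
      using 4(3) unfolding q by blast+
    note part = arrow_block_inverse_partition[OF D1 D2 u1 u2 v1 v2 eq(1) D(2) eq(2,3) inv,
      folded nq]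
    have "j < n"
      using 4(1) by simp
    then show ?case
      using part(1-4) perm_mat_conj2[OF part(5) pl tip_perm_less]
      unfolding Let_def invA part(6) by simp
  qed
qed

end
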